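(* (1) For every test $t$, the map $\rho\mapsto\llbracket t\rrbracket_r(\rho)$ is a measurable function from $\Sigma_r$ to $\mathbb{P}^*\{0,1\}$. (2) If $\mathcal{V}$ is finite or $\mathbf{proj}:\mathbb{R}_e\to\mathbb{F}_e$ is measurable, then for every test $t$, the map $\rho\mapsto\llbracket t\rrbracket_f(\rho)$ is a measurable function from $\Sigma_f$ to $\mathbb{P}^*\{0,1\}$.
   Context: $\mathcal{V}$ is a countable set of variables. Expressions: $e ::= a \mid x \mid \dot{-}e \mid e\,\dot{+}\,e \mid e\,\dot{-}\,e\mid e\,\dot{\times}\, e\mid e\,\dot{/}\,e$ with $a\in\mathbb{Q}$, $x\in\mathcal{V}$. Tests: $t::= e\,\dot{<=}\,e\mid e\,\dot{<}\,e\mid e\,\dot{==}\,e\mid e\,\dot{!=}\,e\mid\, !t$. Values. $\mathbb{F}\subset\mathbb{R}$ is the finite set of (finite) floating-point numbers, with smallest element $F_{\min}$ and largest element $F_{\max}$. Let $\mathbb{R}_e=\mathbb{R}\cup\{\mathbf{err}\}$, $\mathbb{F}_e=\mathbb{F}\cup\{\mathbf{err}\}$, where $\mathbf{err}$ is an extra symbol. Arithmetic is extended to $\mathbb{R}_e$ by: for $r\in\mathbb{R}_e$ and $\diamond\in\{+,-,\times,/\}$, $\mathbf{err}\diamond r=r\diamond\mathbf{err}=r/0=-\mathbf{err}=\mathbf{err}$. $\mathbf{inj}:\mathbb{F}_e\to\mathbb{R}_e$ is the canonical inclusion. $\mathbf{proj}:\mathbb{R}_e\to\mathbb{F}_e$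 is a fixed map with $\mathbf{proj}(r)=\mathbf{err}$ if $r\notin[F_{\min},F_{\max}]$ (in particular if $r=\mathbf{err}$), and $\mathbf{proj}(\mathbf{inj}(f))=f$ for all $f\in\mathbb{F}_e$. Environments. $\Sigma_r$ is the set of maps $\mathcal{V}\to\mathbb{R}_e$, $\Sigma_f$ the set of maps $\mathcal{V}\to\mathbb{F}_e$. Expression semantics. Real: $\llbracket a\rrbracket_r(\rho)=a$, $\llbracket x\rrbracket_r(\rho)=\rho(x)$, $\llbracket \dot{-}e\rrbracket_r(\rho)=-\llbracket e\rrbracket_r(\rho)$, $\llbracket e_1\dot{\diamond}e_2\rrbracket_r(\rho)=\llbracket e_1\rrbracket_r(\rho)\diamond\llbracket e_2\rrbracket_r(\rho)$. Floating-point: $\llbracket a\rrbracket_f(\rho)=\mathbf{proj}(a)$, $\llbracket x\rrbracket_f(\rho)=\rho(x)$, $\llbracket \dot{-}e\rrbracket_f(\rho)=\mathbf{proj}(-\mathbf{inj}(\llbracket e\rrbracket_f(\rho)))$, $\llbracket e_1\dot{\diamond}e_2\rrbracket_f(\rho)=\mathbf{proj}(\mathbf{inj}(\llbracket e_1\rrbracket_f(\rho))\diamond\mathbf{inj}(\llbracket e_2\rrbracket_f(\rho)))$, for $\diamond\in\{+,-,\times,/\}$. Test semantics, for $\star\in\{r,f\}$ and $\rho\in\Sigma_\star$: for a comparison $e_1\,\dot{R}\,e_2$ with $R$ one of $\le,<,=,\ne$ (corresponding to $\dot{<=},\dot{<},\dot{==},\dot{!=}$), $\llbracket e_1\dot{R}e_2\rrbracket_\star(\rho)$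 is $\{0,1\}$ if $\llbracket e_1\rrbracket_\star(\rho)=\mathbf{err}$ or $\llbracket e_2\rrbracket_\star(\rho)=\mathbf{err}$; otherwise it is $\{1\}$ if $\llbracket e_1\rrbracket_\star(\rho)\,R\,\llbracket e_2\rrbracket_\star(\rho)$ holds in $\mathbb{R}$ and $\{0\}$ if not. Moreover $\llbracket !t\rrbracket_\star(\rho)=\{1-v\mid v\in\llbracket t\rrbracket_\star(\rho)\}$. Topology and measurability. $\mathbb{R}_e$ has the topology whose opens are the open subsets of $\mathbb{R}$, the singleton $\{\mathbf{err}\}$, and their unions. $\mathbb{F}_e$ has the discrete topology. $\Sigma_r\cong\mathbb{R}_e^{\mathcal{V}}$ and $\Sigma_f\cong\mathbb{F}_e^{\mathcal{V}}$ have the product topology. All spaces carry their Borel $\sigma$-algebras. $\mathbb{P}^*(Y)$ denotes the set of non-empty subsets of $Y$. For topological spaces $X,Y$, a map $f:X\to\mathbb{P}^*(Y)$ is measurable iff $f^{-1}(\Diamond U)$ is Borel for every open $U\subseteq Y$, where $\Diamond U$ is the set of subsets of $Y$ that intersect $U$. Here $\{0,1\}$ is discrete. *)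

theory Defs
  imports "HOL-Analysis.Analysis"
begin

datatype arith_op = Add | Sub | Mul | Div

datatype (vars_expr: 'v) expr =
    Const rat
  | Var 'v
  | Neg "'v expr"
  | Bin arith_op "'v expr" "'v expr"

datatype cmp_op = Le | Lt | Eq | Ne

datatype (vars_test: 'v) test =
    Cmp cmp_op "'v expr" "'v expr"
  | Not_Test "'v test"

datatype real_e = Err | Num real

text \<open>The floating-point values with error form a subset of \<^typ>\<open>real_e\<close>; the canonical
  inclusion of that subset is therefore the identity and is not written in what follows.\<close>

definition float_e :: "real set \<Rightarrow> real_e set" where
  "float_e F = insert Err (Num ` F)"

definition is_proj :: "real set \<Rightarrow> (real_e \<Rightarrow> real_e) \<Rightarrow> bool" where
  "is_proj F proj \<longleftrightarrow>
     range proj \<subseteq> float_e F \<and>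
     (\<forall>r. r \<notin> Num ` {Min F..Max F} \<longrightarrow> proj r = Err) \<and>
     (\<forall>f\<in>float_e F. proj f = f)"

fun neg_e :: "real_e \<Rightarrow> real_e" where
  "neg_e Err = Err"
| "neg_e (Num a) = Num (- a)"

fun arith_e :: "arith_op \<Rightarrow> real_e \<Rightarrow> real_e \<Rightarrow> real_e" where
  "arith_e _ Err _ = Err"
| "arith_e _ _ Err = Err"
| "arith_e Add (Num a) (Num b) = Num (a + b)"
| "arith_e Sub (Num a) (Num b) = Num (a - b)"
| "arith_e Mul (Num a) (Num b) = Num (a * b)"
| "arith_e Div (Num a) (Num b) = (if b = 0 then Err else Num (a / b))"

primrec expr_r :: "'v expr \<Rightarrow> ('v \<Rightarrow> real_e) \<Rightarrow> real_e" where
  "expr_r (Const a) \<rho> = Num (of_rat a)"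
| "expr_r (Var x) \<rho> = \<rho> x"
| "expr_r (Neg e) \<rho> = neg_e (expr_r e \<rho>)"
| "expr_r (Bin d e1 e2) \<rho> = arith_e d (expr_r e1 \<rho>) (expr_r e2 \<rho>)"

primrec expr_f :: "(real_e \<Rightarrow> real_e) \<Rightarrow> 'v expr \<Rightarrow> ('v \<Rightarrow> real_e) \<Rightarrow> real_e" where
  "expr_f proj (Const a) \<rho> = proj (Num (of_rat a))"
| "expr_f proj (Var x) \<rho> = \<rho> x"
| "expr_f proj (Neg e) \<rho> = proj (neg_e (expr_f proj e \<rho>))"
| "expr_f proj (Bin d e1 e2) \<rho> = proj (arith_e d (expr_f proj e1 \<rho>) (expr_f proj e2 \<rho>))"

fun cmp_holds :: "cmp_op \<Rightarrow> real \<Rightarrow> real \<Rightarrow> bool" where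
  "cmp_holds Le a b \<longleftrightarrow> a \<le> b"
| "cmp_holds Lt a b \<longleftrightarrow> a < b"
| "cmp_holds Eq a b \<longleftrightarrow> a = b"
| "cmp_holds Ne a b \<longleftrightarrow> a \<noteq> b"

fun cmp_e :: "cmp_op \<Rightarrow> real_e \<Rightarrow> real_e \<Rightarrow> int set" where
  "cmp_e _ Err _ = {0, 1}"
| "cmp_e _ _ Err = {0, 1}"
| "cmp_e R (Num a) (Num b) = (if cmp_holds R a b then {1} else {0})"

primrec test_r :: "'v test \<Rightarrow> ('v \<Rightarrow> real_e) \<Rightarrow> int set" where
  "test_r (Cmp R e1 e2) \<rho> = cmp_e R (expr_r e1 \<rho>) (expr_r e2 \<rho>)"
| "test_r (Not_Test t) \<rho> = {1 - v | v. v \<in> test_r t \<rho>}"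

primrec test_f :: "(real_e \<Rightarrow> real_e) \<Rightarrow> 'v test \<Rightarrow> ('v \<Rightarrow> real_e) \<Rightarrow> int set" where
  "test_f proj (Cmp R e1 e2) \<rho> = cmp_e R (expr_f proj e1 \<rho>) (expr_f proj e2 \<rho>)"
| "test_f proj (Not_Test t) \<rho> = {1 - v | v. v \<in> test_f proj t \<rho>}"

definition real_e_top :: "real_e topology" where
  "real_e_top = topology_generated_by (insert {Err} {Num ` W | W. open W})"

definition float_e_top :: "real set \<Rightarrow> real_e topology" where
  "float_e_top F = discrete_topology (float_e F)"

text \<open>Environments over \<open>V\<close> are extensional functions on \<open>V\<close>: the underlying sets of the next two
  spaces are \<open>V \<rightarrow>\<^sub>E UNIV\<close> and \<open>V \<rightarrow>\<^sub>E float_e F\<close>.\<close>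

definition env_r_top :: "'v set \<Rightarrow> ('v \<Rightarrow> real_e) topology" where
  "env_r_top V = product_topology (\<lambda>_. real_e_top) V"

definition env_f_top :: "real set \<Rightarrow> 'v set \<Rightarrow> ('v \<Rightarrow> real_e) topology" where
  "env_f_top F V = product_topology (\<lambda>_. float_e_top F) V"

definition borel_of :: "'a topology \<Rightarrow> 'a measure" where
  "borel_of X = sigma (topspace X) {U. openin X U}"

definition nonempty_subsets :: "'a topology \<Rightarrow> 'a set set" where
  "nonempty_subsets Y = {A. A \<subseteq> topspace Y \<and> A \<noteq> {}}"

definition diamond :: "'a topology \<Rightarrow> 'a set \<Rightarrow> 'a set set" where
  "diamond Y U = {A. A \<subseteq> topspace Y \<and> A \<inter> U \<noteq> {}}"

definition measurable_set_valued :: "'a topology \<Rightarrow> 'b topology \<Rightarrow> ('a \<Rightarrow> 'b set) \<Rightarrow> bool" where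
  "measurable_set_valued X Y f \<longleftrightarrow>
     f \<in> topspace X \<rightarrow> nonempty_subsets Y \<and>
     (\<forall>U. openin Y U \<longrightarrow> f -` diamond Y U \<inter> topspace X \<in> sets (borel_of X))"

lemma openin_real_e_top: "openin real_e_top U \<longleftrightarrow> open (Num -` U)"
proof
  assume "openin real_e_top U"
  then have "generate_topology_on (insert {Err} {Num ` W | W. open W}) U"
    by (simp add: real_e_top_def openin_topology_generated_by_iff)
  then show "open (Num -` U)"
  proof induction
    case (UN K)
    then show ?case by (auto simp: vimage_Union)
  next
    case (Basis s)
    moreover have "Num -` {Err} = {}"
      by auto
    ultimately show ?case by (auto simp: inj_vimage_image_eq inj_def)
  qed auto
next
  assume U: "open (Num -` U)"
  have 1: "openin real_e_top (Num ` (Num -` U))" and 2: "openin real_e_top {Err}"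
    unfolding real_e_top_def using U by (auto intro!: topology_generated_by_Basis)
  have "x \<in> Num ` (Num -` U) \<union> {Err}" if "x \<in> U" for x
    using that by (cases x) auto
  then have "U = Num ` (Num -` U) \<or> U = Num ` (Num -` U) \<union> {Err}"
    by blast
  with 1 2 show "openin real_e_top U" by (metis openin_Un)
qed

lemma topspace_env_r_top: "topspace (env_r_top V) = V \<rightarrow>\<^sub>E UNIV"
proof -
  have "topspace real_e_top = UNIV"
    by (metis UNIV_eq_I openin_real_e_top openin_subset open_UNIV vimage_UNIV UNIV_I subsetD)
  then show ?thesis by (simp add: env_r_top_def)
qed

lemma topspace_env_f_top: "topspace (env_f_top F V) = V \<rightarrow>\<^sub>E float_e F"
  by (simp add: env_f_top_def float_e_top_def)

end

theory Submission
  imports Defs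
begin

text \<open>
  Real expressions are measurable because the arithmetic on \<^typ>\<open>real_e\<close> is Borel arithmetic on
  \<^typ>\<open>real\<close>, cut along the measurable conditions that decide whether the result is \<^const>\<open>Err\<close>.
  Floating-point expressions are measurable for another reason: they take countably many values, and
  a function of two measurable maps with countably many values is measurable, whatever the function.
\<close>

section \<open>Borel sigma-algebras and set-valued measurability\<close>

lemma space_borel_of: "space (borel_of X) = topspace X"
  by (simp add: borel_of_def space_measure_of_conv)

lemma sets_borel_of: "sets (borel_of X) = sigma_sets (topspace X) {U. openin X U}"
  unfolding borel_of_def by (rule sets_measure_of) (auto dest: openin_subset)

lemma borel_of_openin: "openin X U \<Longrightarrow> U \<in> sets (borel_of X)"
  by (simp add: sets_borel_of sigma_sets.Basic)

lemma continuous_map_measurable_borel_of: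
  assumes "continuous_map X Y f"
  shows "f \<in> borel_of X \<rightarrow>\<^sub>M borel_of Y"
proof (rule measurable_sigma_sets[OF sets_borel_of])
  show "{U. openin Y U} \<subseteq> Pow (topspace Y)"
    by (auto dest: openin_subset)
  show "f \<in> space (borel_of X) \<rightarrow> topspace Y"
    using continuous_map_funspace[OF assms] by (simp add: space_borel_of)
  show "f -` U \<inter> space (borel_of X) \<in> sets (borel_of X)" if "U \<in> {U. openin Y U}" for U
  proof -
    have "openin X {x \<in> topspace X. f x \<in> U}"
      using assms that by (auto intro: openin_continuous_map_preimage)
    moreover have "f -` U \<inter> space (borel_of X) = {x \<in> topspace X. f x \<in> U}"
      by (auto simp: space_borel_of)
    ultimately show ?thesis
      by (simp add: borel_of_openin)
  qed
qed

lemma borel_of_euclidean: "borel_of euclidean = borel"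
  by (simp add: borel_of_def borel_def)

text \<open>With \<open>count_space UNIV\<close> as target, the preimage of every family of sets is
  measurable, in particular that of each \<open>diamond Y U\<close>. This discrete notion is easier
  to carry through an induction on tests.\<close>

lemma measurable_set_valuedI:
  assumes "f \<in> borel_of X \<rightarrow>\<^sub>M count_space UNIV"
    and "f \<in> topspace X \<rightarrow> nonempty_subsets Y"
  shows "measurable_set_valued X Y f"
  unfolding measurable_set_valued_def
  using assms measurable_sets[OF assms(1)] by (auto simp: space_borel_of)

text \<open>Freezing first the value \<open>a\<close> of \<open>f\<close> and then the value
  \<open>b\<close> of \<open>g\<close> leaves a constant. The preimage of a set is thus a countable
  union of measurable sets on which both \<open>f\<close> and \<open>g\<close> are constant, so
  \<open>h\<close> only has to map into \<open>C\<close>.\<close>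

lemma measurable_count_space_compose2:
  assumes "f \<in> M \<rightarrow>\<^sub>M count_space A" and "g \<in> M \<rightarrow>\<^sub>M count_space B"
    and "countable A" and "countable B"
    and "\<And>a b. a \<in> A \<Longrightarrow> b \<in> B \<Longrightarrow> h a b \<in> C"
  shows "(\<lambda>x. h (f x) (g x)) \<in> M \<rightarrow>\<^sub>M count_space C"
proof (rule measurable_compose_countable'[OF _ assms(1,3)])
  show "(\<lambda>x. h a (g x)) \<in> M \<rightarrow>\<^sub>M count_space C" if "a \<in> A" for a
    by (rule measurable_compose_countable'[OF _ assms(2,4)]) (simp add: assms(5) that)
qed

section \<open>Real semantics\<close>

fun real_val :: "real_e \<Rightarrow> real" where
  "real_val Err = 0"
| "real_val (Num a) = a"

lemma topspace_real_e_top: "topspace real_e_top = UNIV"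
proof -
  have "openin real_e_top UNIV"
    by (simp add: openin_real_e_top)
  then show ?thesis
    by (metis openin_subset top.extremum_uniqueI)
qed

text \<open>Whether a set is open in \<open>real_e_top\<close> depends only on its preimage under
  \<open>Num\<close>, so \<open>real_val\<close> is continuous whatever default it takes at
  \<open>Err\<close>.\<close>

lemma measurable_real_val: "real_val \<in> borel_of real_e_top \<rightarrow>\<^sub>M borel"
proof -
  have "continuous_map real_e_top euclidean real_val"
    by (simp add: continuous_map topspace_real_e_top openin_real_e_top vimage_def)
  then show ?thesis
    using continuous_map_measurable_borel_of borel_of_euclidean by metis
qed

lemma measurable_Num: "Num \<in> borel \<rightarrow>\<^sub>M borel_of real_e_top"
proof -
  have "continuous_map euclidean real_e_top Num"
    by (simp add: continuous_map topspace_real_e_top openin_real_e_top vimage_def)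
  then show ?thesis
    using continuous_map_measurable_borel_of borel_of_euclidean by metis
qed

lemma pred_eq_Err: "Measurable.pred (borel_of real_e_top) (\<lambda>x. x = Err)"
proof -
  have "Num -` {Err} = {}"
    by auto
  then have "{Err} \<in> sets (borel_of real_e_top)"
    by (intro borel_of_openin) (simp add: openin_real_e_top)
  then show ?thesis
    by (simp add: pred_def space_borel_of topspace_real_e_top)
qed

text \<open>Here and in the two analogous equations below, pattern matching becomes a conditional
  over \<open>real_val\<close>, the form to which the measurability rules for \<open>if\<close>
  apply.\<close>

lemma neg_e_eq: "neg_e a = (if a = Err then Err else Num (- real_val a))"
  by (cases a) auto

text \<open>Total division, with \<open>a / 0 = 0\<close>, is Borel measurable everywhere;
  \<open>arith_e_eq\<close> intercepts a zero divisor before this value can matter.\<close>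

fun arith_op_fun :: "arith_op \<Rightarrow> real \<Rightarrow> real \<Rightarrow> real" where
  "arith_op_fun Add a b = a + b"
| "arith_op_fun Sub a b = a - b"
| "arith_op_fun Mul a b = a * b"
| "arith_op_fun Div a b = a / b"

lemma arith_e_eq:
  "arith_e d a b = (if a = Err \<or> b = Err \<or> d = Div \<and> real_val b = 0 then Err
     else Num (arith_op_fun d (real_val a) (real_val b)))"
  by (cases d; cases a; cases b) auto

lemma cmp_e_eq:
  "cmp_e R a b = (if a = Err \<or> b = Err then {0, 1}
     else if cmp_holds R (real_val a) (real_val b) then {1} else {0})"
  by (cases a; cases b) auto

lemma measurable_arith_op_fun [measurable (raw)]:
  assumes [measurable]: "f \<in> borel_measurable M" "g \<in> borel_measurable M"
  shows "(\<lambda>x. arith_op_fun d (f x) (g x)) \<in> borel_measurable M"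
  by (cases d) simp_all

lemma measurable_cmp_holds [measurable (raw)]:
  assumes [measurable]: "f \<in> borel_measurable M" "g \<in> borel_measurable M"
  shows "Measurable.pred M (\<lambda>x. cmp_holds R (f x) (g x))"
  by (cases R) simp_all

context
  notes [measurable] = measurable_real_val measurable_Num pred_eq_Err
begin

lemma measurable_expr_r:
  assumes "vars_expr e \<subseteq> V"
  shows "expr_r e \<in> borel_of (env_r_top V) \<rightarrow>\<^sub>M borel_of real_e_top"
  using assms
proof (induction e)
  case (Const a)
  show ?case by (simp add: space_borel_of topspace_real_e_top)
next
  case (Var x)
  \<comment> \<open>Since \<open>x\<close> lies in \<open>V\<close>, evaluation at \<open>x\<close>
    is a coordinate projection of the product.\<close>
  then have "continuous_map (env_r_top V) real_e_top (\<lambda>\<rho>. \<rho> x)"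
    unfolding env_r_top_def by (intro continuous_map_product_projection) simp
  then show ?case
    by (simp add: continuous_map_measurable_borel_of)
next
  case (Neg e)
  then have [measurable]: "expr_r e \<in> borel_of (env_r_top V) \<rightarrow>\<^sub>M borel_of real_e_top"
    by simp
  \<comment> \<open>The facts about spaces place the constant branch \<open>Err\<close> in the
    target space.\<close>
  show ?case by (simp add: neg_e_eq space_borel_of topspace_real_e_top)
next
  case (Bin d e1 e2)
  then have [measurable]: "expr_r e1 \<in> borel_of (env_r_top V) \<rightarrow>\<^sub>M borel_of real_e_top"
    "expr_r e2 \<in> borel_of (env_r_top V) \<rightarrow>\<^sub>M borel_of real_e_top"
    by simp_all
  show ?case by (simp add: arith_e_eq space_borel_of topspace_real_e_top)
qed

lemma measurable_test_r:
  assumes "vars_test t \<subseteq> V"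
  shows "test_r t \<in> borel_of (env_r_top V) \<rightarrow>\<^sub>M count_space UNIV"
  using assms
proof (induction t)
  case (Cmp R e1 e2)
  then have [measurable]: "expr_r e1 \<in> borel_of (env_r_top V) \<rightarrow>\<^sub>M borel_of real_e_top"
    "expr_r e2 \<in> borel_of (env_r_top V) \<rightarrow>\<^sub>M borel_of real_e_top"
    by (simp_all add: measurable_expr_r)
  show ?case by (simp add: cmp_e_eq)
next
  case (Not_Test t)
  then have "test_r t \<in> borel_of (env_r_top V) \<rightarrow>\<^sub>M count_space UNIV"
    by simp
  \<comment> \<open>Every map out of \<open>count_space UNIV\<close> is measurable, so negation is a
    mere composition.\<close>
  from measurable_compose[OF this, of "\<lambda>A. {1 - v | v. v \<in> A}" "count_space UNIV"]
  show ?case by simp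
qed

end

section \<open>Floating-point semantics\<close>

lemma countable_float_e: "countable F \<Longrightarrow> countable (float_e F)"
  by (simp add: float_e_def)

text \<open>Variables range over the countable set \<open>float_e F\<close>, and \<open>proj\<close>
  brings every constant and every result back to it. Measurability therefore passes through unary
  operations by composition and through binary ones by
  \<open>measurable_count_space_compose2\<close>.\<close>

lemma measurable_expr_f:
  assumes "countable F" and "range proj \<subseteq> float_e F" and "vars_expr e \<subseteq> V"
  shows "expr_f proj e \<in> borel_of (env_f_top F V) \<rightarrow>\<^sub>M count_space (float_e F)"
  using assms(3)
proof (induction e)
  case (Const a)
  have "proj (Num (of_rat a)) \<in> float_e F"
    using assms(2) by blast
  then show ?case by simp
next
  case (Var x)
  then have "continuous_map (env_f_top F V) (float_e_top F) (\<lambda>\<rho>. \<rho> x)"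
    unfolding env_f_top_def by (intro continuous_map_product_projection) simp
  then have "(\<lambda>\<rho>. \<rho> x) \<in> borel_of (env_f_top F V) \<rightarrow>\<^sub>M borel_of (float_e_top F)"
    by (rule continuous_map_measurable_borel_of)
  \<comment> \<open>Every subset of \<open>float_e F\<close> is open, so the generators already form
    the full power set, which is a sigma-algebra.\<close>
  moreover have sets_eq: "sets (borel_of (float_e_top F)) = sets (count_space (float_e F))"
    using sigma_algebra.sigma_sets_eq[OF sigma_algebra_Pow, of "float_e F"]
    by (simp add: sets_borel_of float_e_top_def Pow_def)
  ultimately show ?case
    by (simp add: measurable_cong_sets[OF refl sets_eq])
next
  case (Neg e)
  then have "expr_f proj e \<in> borel_of (env_f_top F V) \<rightarrow>\<^sub>M count_space (float_e F)"
    by simp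
  \<comment> \<open>Out of a \<open>count_space\<close>, only the range of the map has to be
    checked.\<close>
  moreover have "(\<lambda>a. proj (neg_e a)) \<in> count_space (float_e F) \<rightarrow>\<^sub>M count_space (float_e F)"
    using assms(2) by auto
  ultimately show ?case
    unfolding expr_f.simps by (rule measurable_compose)
next
  case (Bin d e1 e2)
  then show ?case
    using assms(2) countable_float_e[OF assms(1)]
    by (simp, intro measurable_count_space_compose2[where h = "\<lambda>a b. proj (arith_e d a b)"
          and A = "float_e F" and B = "float_e F"]) auto
qed

lemma measurable_test_f:
  assumes "countable F" and "range proj \<subseteq> float_e F" and "vars_test t \<subseteq> V"
  shows "test_f proj t \<in> borel_of (env_f_top F V) \<rightarrow>\<^sub>M count_space UNIV"
  using assms(3)
proof (induction t)
  case (Cmp R e1 e2)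
  then show ?case
    using measurable_expr_f[OF assms(1,2)] countable_float_e[OF assms(1)]
    by (simp, intro measurable_count_space_compose2[where h = "cmp_e R"
          and A = "float_e F" and B = "float_e F"]) auto
next
  case (Not_Test t)
  then have "test_f proj t \<in> borel_of (env_f_top F V) \<rightarrow>\<^sub>M count_space UNIV"
    by simp
  from measurable_compose[OF this, of "\<lambda>A. {1 - v | v. v \<in> A}" "count_space UNIV"]
  show ?case by simp
qed

section \<open>Non-empty values and conclusion\<close>

lemma cmp_e_nonempty_subsets: "cmp_e R a b \<in> nonempty_subsets (discrete_topology {0, 1})"
  by (simp add: cmp_e_eq nonempty_subsets_def)

text \<open>The map \<open>v \<mapsto> 1 - v\<close> swaps 0 and 1. This is the negation step
  towards the second premise of \<open>measurable_set_valuedI\<close>.\<close>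

lemma complement_nonempty_subsets:
  fixes A :: "int set"
  assumes "A \<in> nonempty_subsets (discrete_topology {0, 1})"
  shows "{1 - v | v. v \<in> A} \<in> nonempty_subsets (discrete_topology {0, 1})"
  using assms by (auto simp: nonempty_subsets_def)

lemma test_r_nonempty_subsets: "test_r t \<rho> \<in> nonempty_subsets (discrete_topology {0, 1})"
  by (induction t) (simp_all add: cmp_e_nonempty_subsets complement_nonempty_subsets)

lemma test_f_nonempty_subsets: "test_f proj t \<rho> \<in> nonempty_subsets (discrete_topology {0, 1})"
  by (induction t) (simp_all add: cmp_e_nonempty_subsets complement_nonempty_subsets)

theorem proposition2:
  fixes V :: "'v set" and F :: "real set" and proj :: "real_e \<Rightarrow> real_e"
  assumes "countable V"
    and "finite F" and "F \<noteq> {}"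
    and "is_proj F proj"
  shows "(\<forall>t. vars_test t \<subseteq> V \<longrightarrow>
            measurable_set_valued (env_r_top V) (discrete_topology {0, 1}) (test_r t))
       \<and> (finite V \<or> proj \<in> borel_of real_e_top \<rightarrow>\<^sub>M borel_of (float_e_top F) \<longrightarrow>
            (\<forall>t. vars_test t \<subseteq> V \<longrightarrow>
               measurable_set_valued (env_f_top F V) (discrete_topology {0, 1}) (test_f proj t)))"
proof -
  have "countable F" and "range proj \<subseteq> float_e F"
    using assms by (simp_all add: countable_finite is_proj_def)
  then show ?thesis
    by (blast intro: measurable_set_valuedI measurable_test_r measurable_test_f
        test_r_nonempty_subsets test_f_nonempty_subsets)
qed

end
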